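(* Let $G$ and $H$ be finite graphs and let $r,s$ be non-negative integers with $1\leq \frac{2r+1}{2s+1}< og(G)$. Then $G^{\frac{2r+1}{2s+1}}\longrightarrow H$ if and only if $G\longrightarrow H^{-\frac{2s+1}{2r+1}}$.
   Context: All graphs are finite. A homomorphism $G\to H$ is a map $V(G)\to V(H)$ sending adjacent vertices to adjacent vertices; $G\longrightarrow H$ means such a homomorphism exists. $og(G)$ denotes the odd girth of $G$ (length of a shortest odd cycle; $og(G)=\infty$ if $G$ is bipartite). For a positive integer $k$, the $k$th power $G^{k}$ has vertex set $V(G)$, with $u,v$ adjacent iff there is a walk of length $k$ between $u$ and $v$ in $G$ (loops are allowed). $S_t(G)$ is obtained from $G$ by replacing each edge by a path with exactly $t-1$ inner vertices. For non-negative integers $r,s$, $G^{\frac{2r+1}{2s+1}}:=(S_{2s+1}(G))^{2r+1}$. For $v\in V(G)$ and $i\ge 0$, $N_i(v)$ is the set of vertices $u$ such that there is a walk of length $i$ joining $u$ and $v$ (so $N_0(v)=\{v\}$), and for a set $A$ of vertices $N_i(A)=\bigcup_{v\in A}N_i(v)$. For a non-negative integer $r$, the graph $H^{-\frac{1}{2r+1}}$ has as vertices all $(r+1)$-tuples $(A_1,\ldots,A_{r+1})$ of subsets of $V(H)$ with $|A_1|=1$ and $\emptyset\neq A_i\subseteq N_{i-1}(A_1)$ for all $i\leq r+1$; two vertices $(A_1,\ldots,A_{r+1})$ and $(B_1,\ldots,B_{r+1})$ are adjacent iff $A_i\subseteq B_{i+1}$ and $B_i\subseteq A_{i+1}$ for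 all $1\le i\le r$, and for every $1\le j\le r+1$ every vertex of $A_j$ is adjacent in $H$ to every vertex of $B_j$. Finally, $H^{-\frac{2s+1}{2r+1}}:=(H^{-\frac{1}{2r+1}})^{2s+1}$.
   Formalization: The formal theorem additionally assumes that r = 0 or at least one of G, H has an edge; without this the claim fails, e.g. for G = H = K_1, r = 1, s = 0, where G^3 maps to H but H^{-1/3} has no vertices. *)

theory Defs
  imports "Graph_Theory.Graph_Theory" "HOL-Library.Extended_Real"
begin

text \<open>
  A finite graph, possibly with loops, is a \<^locale>\<open>pair_pseudo_graph\<close>: a finite digraph
  whose arc relation is symmetric, each edge \<open>uv\<close> giving the arcs \<open>(u, v)\<close> and \<open>(v, u)\<close>.
  Loops cannot be excluded, since powers of loopless graphs may have them.
\<close>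

definition graph_hom ::
  "'a pair_pre_digraph \<Rightarrow> 'b pair_pre_digraph \<Rightarrow> ('a \<Rightarrow> 'b) \<Rightarrow> bool" where
  "graph_hom G H f \<longleftrightarrow>
     (\<forall>v \<in> pverts G. f v \<in> pverts H) \<and>
     (\<forall>u v. (u, v) \<in> parcs G \<longrightarrow> (f u, f v) \<in> parcs H)"

definition hom_exists ::
  "'a pair_pre_digraph \<Rightarrow> 'b pair_pre_digraph \<Rightarrow> bool" (infix \<open>\<longrightarrow>\<^sub>h\<close> 50) where
  "G \<longrightarrow>\<^sub>h H \<longleftrightarrow> (\<exists>f. graph_hom G H f)"

text \<open>
  In a symmetric digraph \<open>pre_digraph.cycle\<close> also accepts the closed walks \<open>u, v, u\<close>; these have
  length 2, so they do not affect odd cycles. A loop is an odd cycle of length 1. The infimum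
  of the empty set is \<open>\<infinity>\<close>.
\<close>

definition odd_girth :: "'a pair_pre_digraph \<Rightarrow> enat" where
  "odd_girth G =
     (INF p \<in> {p. pre_digraph.cycle (with_proj G) p \<and> odd (length p)}. enat (length p))"

definition walk_nbhd :: "'a pair_pre_digraph \<Rightarrow> nat \<Rightarrow> 'a \<Rightarrow> 'a set" where
  "walk_nbhd G i v = {u. \<exists>p. pre_digraph.awalk (with_proj G) v p u \<and> length p = i}"

definition walk_nbhd_set :: "'a pair_pre_digraph \<Rightarrow> nat \<Rightarrow> 'a set \<Rightarrow> 'a set" where
  "walk_nbhd_set G i A = (\<Union>v \<in> A. walk_nbhd G i v)"

definition graph_power :: "nat \<Rightarrow> 'a pair_pre_digraph \<Rightarrow> 'a pair_pre_digraph" where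
  "graph_power k G =
     \<lparr> pverts = pverts G,
       parcs = {(u, v). \<exists>p. pre_digraph.awalk (with_proj G) u p v \<and> length p = k} \<rparr>"

datatype 'a subdiv_vertex = Branch 'a | Inner "('a \<times> 'a \<times> nat) set"

text \<open>
  \<open>subdiv_point t u v i\<close> is the point at distance \<open>i \<le> t\<close> from \<open>u\<close> on the path of length \<open>t\<close> that
  replaces the edge \<open>uv\<close>. Read from the other end, it is the point at distance \<open>t - i\<close> from
  \<open>v\<close> on \<open>vu\<close>, so an inner point of a non-loop is named by the set of both descriptions.
  On a loop the points at \<open>i\<close> and \<open>t - i\<close> are different and are not identified.
\<close>

definition subdiv_point :: "nat \<Rightarrow> 'a \<Rightarrow> 'a \<Rightarrow> nat \<Rightarrow> 'a subdiv_vertex" where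
  "subdiv_point t u v i =
     (if i = 0 then Branch u
      else if i = t then Branch v
      else if u = v then Inner {(u, v, i)}
      else Inner {(u, v, i), (v, u, t - i)})"

definition subdivide :: "nat \<Rightarrow> 'a pair_pre_digraph \<Rightarrow> 'a subdiv_vertex pair_pre_digraph" where
  "subdivide t G =
     (let S = {(subdiv_point t u v i, subdiv_point t u v (Suc i)) | u v i.
                 (u, v) \<in> parcs G \<and> i < t}
      in \<lparr> pverts = Branch ` pverts G \<union>
             {subdiv_point t u v i | u v i. (u, v) \<in> parcs G \<and> 0 < i \<and> i < t},
           parcs = S \<union> S\<inverse> \<rparr>)"

text \<open>\<open>frac_power r s G\<close> is the power of \<open>G\<close> with exponent \<open>(2r+1)/(2s+1)\<close>.\<close>

definition frac_power ::
  "nat \<Rightarrow> nat \<Rightarrow> 'a pair_pre_digraph \<Rightarrow> 'a subdiv_vertex pair_pre_digraph" where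
  "frac_power r s G = graph_power (2 * r + 1) (subdivide (2 * s + 1) G)"

text \<open>
  \<open>inv_power r H\<close> is the power of \<open>H\<close> with exponent \<open>-1/(2r+1)\<close>. The tuple
  \<open>(A\<^sub>1, \<dots>, A\<^sub>r\<^sub>+\<^sub>1)\<close> is a list of length \<open>r + 1\<close> indexed from 0, so \<open>A\<^sub>i\<close> is \<open>A ! (i - 1)\<close>.
\<close>

definition inv_power_verts :: "nat \<Rightarrow> 'b pair_pre_digraph \<Rightarrow> 'b set list set" where
  "inv_power_verts r H =
     {A. length A = r + 1 \<and>
         (\<forall>i \<le> r. A ! i \<subseteq> pverts H) \<and>
         card (A ! 0) = 1 \<and>
         (\<forall>i \<le> r. A ! i \<noteq> {} \<and> A ! i \<subseteq> walk_nbhd_set H i (A ! 0))}"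

definition inv_power :: "nat \<Rightarrow> 'b pair_pre_digraph \<Rightarrow> 'b set list pair_pre_digraph" where
  "inv_power r H =
     \<lparr> pverts = inv_power_verts r H,
       parcs = {(A, B). A \<in> inv_power_verts r H \<and> B \<in> inv_power_verts r H \<and>
                  (\<forall>i < r. A ! i \<subseteq> B ! (i + 1) \<and> B ! i \<subseteq> A ! (i + 1)) \<and>
                  (\<forall>j \<le> r. \<forall>x \<in> A ! j. \<forall>y \<in> B ! j. (x, y) \<in> parcs H)} \<rparr>"

text \<open>\<open>neg_frac_power s r H\<close> is the power of \<open>H\<close> with exponent \<open>-(2s+1)/(2r+1)\<close>.\<close>

definition neg_frac_power ::
  "nat \<Rightarrow> nat \<Rightarrow> 'b pair_pre_digraph \<Rightarrow> 'b set list pair_pre_digraph" where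
  "neg_frac_power s r H = graph_power (2 * s + 1) (inv_power r H)"

lemma awalk_edgeless:
  "pre_digraph.awalk (with_proj G) u p v \<Longrightarrow> parcs G = {} \<Longrightarrow> p = []"
  by (simp add: pre_digraph.awalk_def)

text \<open>
  For edgeless graphs with nonempty vertex sets and \<open>r > 0\<close> the duality between the two powers
  fails: \<open>inv_power r H\<close> has no vertices, because no walk of length 1 starts at a vertex of \<open>H\<close>.
\<close>

lemma edgeless_counterexample:
  fixes G :: "'a pair_pre_digraph" and H :: "'b pair_pre_digraph" and r s :: nat
  assumes "parcs G = {}" "parcs H = {}" "pverts G \<noteq> {}" "pverts H \<noteq> {}" "r > 0"
  shows "frac_power r s G \<longrightarrow>\<^sub>h H" and "\<not> G \<longrightarrow>\<^sub>h neg_frac_power s r H"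
    and "odd_girth G = \<infinity>"
proof -
  obtain h where h: "h \<in> pverts H" using assms(4) by blast
  have "parcs (subdivide (2 * s + 1) G) = {}"
    using assms(1) by (simp add: subdivide_def)
  then have "parcs (frac_power r s G) = {}"
    using awalk_edgeless[of "subdivide (2 * s + 1) G"]
    by (fastforce simp: frac_power_def graph_power_def)
  then have "graph_hom (frac_power r s G) H (\<lambda>_. h)"
    using h by (simp add: graph_hom_def)
  then show "frac_power r s G \<longrightarrow>\<^sub>h H"
    unfolding hom_exists_def by blast
  have no_nbhd: "walk_nbhd_set H 1 X = {}" for X
    using awalk_edgeless[OF _ assms(2)] by (fastforce simp: walk_nbhd_set_def walk_nbhd_def)
  have "A \<notin> inv_power_verts r H" for A
  proof
    assume "A \<in> inv_power_verts r H"
    moreover have "1 \<le> r" using assms(5) by simp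
    ultimately have "A ! 1 \<noteq> {}" "A ! 1 \<subseteq> walk_nbhd_set H 1 (A ! 0)"
      unfolding inv_power_verts_def by blast+
    then show False using no_nbhd[of "A ! 0"] by blast
  qed
  then show "\<not> G \<longrightarrow>\<^sub>h neg_frac_power s r H"
    using assms(3)
    by (auto simp: hom_exists_def graph_hom_def neg_frac_power_def graph_power_def inv_power_def)
  have "{p. pre_digraph.cycle (with_proj G) p \<and> odd (length p)} = {}"
    using awalk_edgeless[OF _ assms(1)] unfolding pre_digraph.cycle_def by blast
  then show "odd_girth G = \<infinity>"
    by (simp only: odd_girth_def image_empty Inf_empty top_enat_def)
qed

end

theory Submission
  imports Defs
begin

text \<open>
  The exponent is split into two independent dualities. Subdividing is left adjoint to taking
  powers: a homomorphism \<open>S\<^sub>t(G) \<longrightarrow> K\<close> is a homomorphism from \<open>G\<close> to \<open>K\<^sup>t\<close> together with a choice of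
  walks of length \<open>t\<close>. Taking the power \<open>2r+1\<close> is left adjoint to the inverse power: a homomorphism
  \<open>f : K\<^sup>2\<^sup>r\<^sup>+\<^sup>1 \<longrightarrow> H\<close> induces \<open>v \<mapsto> (f(N\<^sub>0(v)), \<dots>, f(N\<^sub>r(v)))\<close>, because vertices of \<open>N\<^sub>j(u)\<close> and \<open>N\<^sub>j(v)\<close>
  for adjacent \<open>u, v\<close> are joined by a walk of odd length at most \<open>2r+1\<close>, which can be prolonged by
  traversing an edge back and forth. Conversely, given a homomorphism into the inverse power and a
  walk of length \<open>2r+1\<close>, the first components at its two ends propagate along the chain of
  inclusions to the last components at the two middle vertices, which are completely joined.
\<close>

section \<open>Walks as powers of a symmetric relation\<close>

lemma pair_sym_digraph_iff:
  "pair_sym_digraph G \<longleftrightarrow> parcs G \<subseteq> pverts G \<times> pverts G \<and> sym (parcs G)"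
  by (fastforce simp: pair_sym_digraph_def pair_sym_digraph_axioms_def pair_wf_digraph_def
      symmetric_def)

lemma relpow_odd_if_sym:
  assumes "sym R" "(u, v) \<in> R"
  shows "(u, v) \<in> R ^^ (2 * m + 1)"
proof (induction m)
  case 0
  then show ?case using assms by simp
next
  case (Suc m)
  have "(v, u) \<in> R" using assms by (rule symD)
  then have "(u, v) \<in> R ^^ Suc (Suc (2 * m + 1))"
    using Suc assms(2) by (meson relpow_Suc_I)
  then show ?case by simp
qed

lemma relpow_sym: "sym R \<Longrightarrow> (u, v) \<in> R ^^ n \<Longrightarrow> (v, u) \<in> R ^^ n"
proof (induction n arbitrary: v)
  case (Suc n)
  then obtain w where "(u, w) \<in> R ^^ n" "(w, v) \<in> R" by auto
  then show ?case using Suc by (meson relpow_Suc_I2 symD)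
qed auto

text \<open>An odd walk has a last edge, which is traversed back and forth until the length is
  \<open>2 * r + 1\<close>.\<close>

lemma relpow_odd_mono_if_sym:
  assumes "sym R" "(u, v) \<in> R ^^ (2 * j + 1)" "j \<le> r"
  shows "(u, v) \<in> R ^^ (2 * r + 1)"
proof -
  obtain w where "(u, w) \<in> R ^^ (2 * j)" "(w, v) \<in> R" using assms(2) by auto
  then have "(u, v) \<in> R ^^ (2 * j) O R ^^ (2 * (r - j) + 1)"
    using relpow_odd_if_sym[OF assms(1)] by blast
  also have "\<dots> = R ^^ (2 * r + 1)"
    unfolding relpow_add[symmetric] using assms(3) by (simp add: algebra_simps del: relpow.simps)
  finally show ?thesis .
qed

text \<open>Oscillating on the edge gives every odd length, and deleting the last step of such a
  walk gives the even ones. Hence the neighbourhoods of a non-isolated vertex are nonempty.\<close>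

lemma relpow_nonempty_if_sym:
  assumes "sym R" "(u, v) \<in> R"
  shows "\<exists>w. (u, w) \<in> R ^^ n"
proof (cases "even n")
  case True
  then obtain m where m: "n = 2 * m" by (elim evenE)
  have "(v, u) \<in> R" using assms by (rule symD)
  then have "(u, u) \<in> R ^^ (2 * m + 1) O R"
    using relpow_odd_if_sym[OF assms] by blast
  then have "(u, u) \<in> R O R ^^ (2 * m + 1)" by (simp only: relpow_commute)
  then have "\<exists>w. (u, w) \<in> R ^^ (2 * m)" using relpow_odd_if_sym[OF assms] by auto
  then show ?thesis using m by simp
next
  case False
  then obtain m where "n = 2 * m + 1" by (elim oddE)
  then show ?thesis using relpow_odd_if_sym[OF assms] by blast
qed

text \<open>Vertex membership is explicit because \<open>parcs G ^^ 0\<close> is the identity on the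
  whole type, whereas an empty walk starts at a vertex of \<open>G\<close>.\<close>

lemma awalk_iff_relpow:
  assumes "pair_sym_digraph G"
  shows "(\<exists>p. pre_digraph.awalk (with_proj G) u p v \<and> length p = n) \<longleftrightarrow>
    u \<in> pverts G \<and> (u, v) \<in> parcs G ^^ n"
proof -
  interpret pair_sym_digraph G by (fact assms)
  show ?thesis
  proof (induction n arbitrary: u)
    case 0
    then show ?case by (auto simp: awalk_Nil_iff)
  next
    case (Suc n)
    have "(\<exists>p. awalk u p v \<and> length p = Suc n) \<longleftrightarrow>
        (\<exists>w. (u, w) \<in> parcs G \<and> (\<exists>p. awalk w p v \<and> length p = n))"
    proof (intro iffI; elim exE conjE)
      fix p assume "awalk u p v" "length p = Suc n"
      then show "\<exists>w. (u, w) \<in> parcs G \<and> (\<exists>p. awalk w p v \<and> length p = n)"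
        by (cases p) (auto simp: awalk_Cons_iff intro!: exI)
    next
      fix w p assume "(u, w) \<in> parcs G" "awalk w p v" "length p = n"
      then have "awalk u ((u, w) # p) v \<and> length ((u, w) # p) = Suc n"
        by (simp add: awalk_Cons_iff)
      then show "\<exists>p. awalk u p v \<and> length p = Suc n" by blast
    qed
    also have "\<dots> \<longleftrightarrow> (\<exists>w. (u, w) \<in> parcs G \<and> (w, v) \<in> parcs G ^^ n)"
      using in_arcsD2 unfolding Suc.IH by blast
    also have "\<dots> \<longleftrightarrow> u \<in> pverts G \<and> (u, v) \<in> parcs G ^^ Suc n"
      using in_arcsD1 by (meson relpow_Suc_D2 relpow_Suc_I2)
    finally show ?case .
  qed
qed

lemma walk_nbhd_relpow:
  "pair_sym_digraph G \<Longrightarrow> walk_nbhd G i v = {u. v \<in> pverts G \<and> (v, u) \<in> parcs G ^^ i}"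
  by (simp add: walk_nbhd_def awalk_iff_relpow)

lemma arc_graph_power_iff:
  "pair_sym_digraph G \<Longrightarrow>
    (u, v) \<in> parcs (graph_power n G) \<longleftrightarrow> u \<in> pverts G \<and> (u, v) \<in> parcs G ^^ n"
  by (simp add: graph_power_def awalk_iff_relpow)

lemma pverts_graph_power [simp]: "pverts (graph_power n G) = pverts G"
  by (simp add: graph_power_def)

lemma relpow_hom:
  assumes "\<And>u v. (u, v) \<in> R \<Longrightarrow> (f u, f v) \<in> S" "(u, v) \<in> R ^^ n"
  shows "(f u, f v) \<in> S ^^ n"
  using assms(2) by (induction n arbitrary: v) (use assms(1) in fastforce)+

lemma pair_sym_digraph_inv_power:
  assumes "pair_sym_digraph H"
  shows "pair_sym_digraph (inv_power r H)"
  using assms by (auto simp: pair_sym_digraph_iff inv_power_def sym_def)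

section \<open>Subdivisions and powers\<close>

lemma pverts_subdivide:
  "pverts (subdivide t G) =
    Branch ` pverts G \<union> {subdiv_point t u v i | u v i. (u, v) \<in> parcs G \<and> 0 < i \<and> i < t}"
  by (simp add: subdivide_def Let_def)

lemma arc_subdivide_iff:
  "(x, y) \<in> parcs (subdivide t G) \<longleftrightarrow>
    (\<exists>u v i. (u, v) \<in> parcs G \<and> i < t \<and>
      (x = subdiv_point t u v i \<and> y = subdiv_point t u v (Suc i) \<or>
       y = subdiv_point t u v i \<and> x = subdiv_point t u v (Suc i)))"
  by (auto simp: subdivide_def Let_def)

lemma pair_sym_digraph_subdivide:
  assumes "pair_sym_digraph G"
  shows "pair_sym_digraph (subdivide t G)"
proof -
  have G: "parcs G \<subseteq> pverts G \<times> pverts G" using assms by (simp add: pair_sym_digraph_iff)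
  have "subdiv_point t u v i \<in> pverts (subdivide t G)" if "(u, v) \<in> parcs G" "i \<le> t" for u v i
  proof (cases "i = 0 \<or> i = t")
    case True
    then show ?thesis using that G by (auto simp: pverts_subdivide subdiv_point_def)
  next
    case False
    then show ?thesis using that by (force simp: pverts_subdivide)
  qed
  then have "parcs (subdivide t G) \<subseteq> pverts (subdivide t G) \<times> pverts (subdivide t G)"
    by (auto simp: arc_subdivide_iff)
  moreover have "sym (parcs (subdivide t G))"
    unfolding sym_def arc_subdivide_iff by blast
  ultimately show ?thesis by (simp add: pair_sym_digraph_iff)
qed

text \<open>An inner point of a non-loop has two descriptions; the first hypothesis makes
  \<open>F\<close> agree on them, so it does not matter which one \<open>SOME\<close> picks. On a
  loop the name is a singleton.\<close>

lemma subdivision_map_exists: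
  assumes "\<And>u v i. \<lbrakk>(u, v) \<in> R; u \<noteq> v; 0 < i; i < t\<rbrakk> \<Longrightarrow> F v u (t - i) = F u v i"
    and "\<And>u v. (u, v) \<in> R \<Longrightarrow> F u v 0 = g u \<and> F u v t = g v"
  shows "\<exists>f. (\<forall>u. f (Branch u) = g u) \<and>
    (\<forall>u v i. (u, v) \<in> R \<longrightarrow> i \<le> t \<longrightarrow> f (subdiv_point t u v i) = F u v i)"
proof -
  define f where "f = case_subdiv_vertex g (\<lambda>S. case (SOME x. x \<in> S) of (u, v, i) \<Rightarrow> F u v i)"
  have "f (subdiv_point t u v i) = F u v i" if R: "(u, v) \<in> R" and i: "i \<le> t" for u v i
  proof (cases "i = 0 \<or> i = t \<or> u = v")
    case True
    then show ?thesis using assms(2)[OF R] by (auto simp: f_def subdiv_point_def)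
  next
    case False
    define x where "x = (SOME x. x \<in> {(u, v, i), (v, u, t - i)})"
    have "x \<in> {(u, v, i), (v, u, t - i)}" unfolding x_def by (rule someI_ex) blast
    moreover have "f (subdiv_point t u v i) = (case x of (u, v, i) \<Rightarrow> F u v i)"
      using False by (simp add: f_def subdiv_point_def x_def)
    ultimately show ?thesis using assms(1)[OF R] False i by auto
  qed
  moreover have "f (Branch u) = g u" for u by (simp add: f_def)
  ultimately show ?thesis by blast
qed

text \<open>Walks chosen independently for \<open>(u, v)\<close> and \<open>(v, u)\<close> need not
  be reverses of each other, so one orientation receives the reversal of the other's walk. Loops are
  exempt, as their points are not identified.\<close>

lemma symmetric_walk_choice:
  assumes "sym R" "sym S" "\<And>u v. (u, v) \<in> R \<Longrightarrow> (g u, g v) \<in> S ^^ t"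
  obtains F where
    "\<And>u v i. \<lbrakk>(u, v) \<in> R; u \<noteq> v; i \<le> t\<rbrakk> \<Longrightarrow> F v u (t - i) = F u v i"
    "\<And>u v. (u, v) \<in> R \<Longrightarrow> F u v 0 = g u \<and> F u v t = g v"
    "\<And>u v i. \<lbrakk>(u, v) \<in> R; i < t\<rbrakk> \<Longrightarrow> (F u v i, F u v (Suc i)) \<in> S"
proof -
  have "\<exists>W. \<forall>u v. (u, v) \<in> R \<longrightarrow>
      W u v 0 = g u \<and> W u v t = g v \<and> (\<forall>i<t. (W u v i, W u v (Suc i)) \<in> S)"
    using assms(3) unfolding relpow_fun_conv by metis
  then obtain W where
    W: "\<And>u v. (u, v) \<in> R \<Longrightarrow> W u v 0 = g u \<and> W u v t = g v"
      "\<And>u v i. \<lbrakk>(u, v) \<in> R; i < t\<rbrakk> \<Longrightarrow> (W u v i, W u v (Suc i)) \<in> S"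
    by blast
  \<comment> \<open>\<open>pos\<close> selects exactly one of the two orientations of every non-loop.\<close>
  define pos where "pos u v \<longleftrightarrow> (SOME x. x \<in> {u, v}) = u" for u v :: 'a
  have some: "(SOME x. x \<in> {u, v}) \<in> {u, v}" for u v :: 'a by (rule someI_ex) blast
  have pos: "pos v u \<longleftrightarrow> \<not> pos u v" if "u \<noteq> v" for u v
    using some[of u v] that by (auto simp: pos_def insert_commute)
  define F where "F u v i = (if pos u v then W u v i else W v u (t - i))" for u v i
  show ?thesis
  proof
    show "F v u (t - i) = F u v i" if "(u, v) \<in> R" "u \<noteq> v" "i \<le> t" for u v i
      using that(3) pos[OF that(2)] by (cases "pos u v") (simp_all add: F_def)
    show "F u v 0 = g u \<and> F u v t = g v" if "(u, v) \<in> R" for u v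
      using W(1) that symD[OF assms(1) that] by (simp add: F_def)
    show "(F u v i, F u v (Suc i)) \<in> S" if "(u, v) \<in> R" "i < t" for u v i
    proof (cases "pos u v")
      case True
      then show ?thesis using W(2) that by (simp add: F_def)
    next
      case False
      \<comment> \<open>Step \<open>i\<close> of the reversed walk is this step of
        \<open>W v u\<close> taken backwards, so symmetry of \<open>S\<close> applies.\<close>
      have "(W v u (t - Suc i), W v u (Suc (t - Suc i))) \<in> S"
        using W(2)[OF symD[OF assms(1) that(1)]] that(2) by simp
      then show ?thesis
        using False symD[OF assms(2)] that(2) by (simp add: F_def Suc_diff_Suc)
    qed
  qed
qed

theorem subdivide_hom_iff:
  assumes "pair_sym_digraph G" "pair_sym_digraph K" "t > 0"
  shows "subdivide t G \<longrightarrow>\<^sub>h K \<longleftrightarrow> G \<longrightarrow>\<^sub>h graph_power t K"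
proof
  assume "subdivide t G \<longrightarrow>\<^sub>h K"
  then obtain f where f: "graph_hom (subdivide t G) K f" by (auto simp: hom_exists_def)
  have verts: "f (Branch u) \<in> pverts K" if "u \<in> pverts G" for u
    using f that by (simp add: graph_hom_def pverts_subdivide)
  have "(f (Branch u), f (Branch v)) \<in> parcs K ^^ t" if uv: "(u, v) \<in> parcs G" for u v
  proof -
    have "(f (subdiv_point t u v i), f (subdiv_point t u v (Suc i))) \<in> parcs K" if "i < t" for i
      using f uv that unfolding graph_hom_def arc_subdivide_iff by blast
    \<comment> \<open>\<open>subdiv_point\<close> tests \<open>i = 0\<close> before
      \<open>i = t\<close>, so the second equation rests on \<open>t > 0\<close>.\<close>
    moreover have "subdiv_point t u v 0 = Branch u" "subdiv_point t u v t = Branch v"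
      using assms(3) by (simp_all add: subdiv_point_def)
    ultimately show ?thesis
      unfolding relpow_fun_conv by (intro exI[of _ "\<lambda>i. f (subdiv_point t u v i)"]) simp
  qed
  then have "graph_hom G (graph_power t K) (\<lambda>u. f (Branch u))"
    using verts assms(1,2) by (auto simp: graph_hom_def arc_graph_power_iff pair_sym_digraph_iff)
  then show "G \<longrightarrow>\<^sub>h graph_power t K" by (auto simp: hom_exists_def)
next
  assume "G \<longrightarrow>\<^sub>h graph_power t K"
  then obtain g where g: "graph_hom G (graph_power t K) g" by (auto simp: hom_exists_def)
  have sym: "sym (parcs G)" "sym (parcs K)" and K: "parcs K \<subseteq> pverts K \<times> pverts K"
    using assms by (simp_all add: pair_sym_digraph_iff)
  have "(g u, g v) \<in> parcs K ^^ t" if "(u, v) \<in> parcs G" for u v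
    using g that assms(2) by (simp add: graph_hom_def arc_graph_power_iff)
  then obtain F where F:
    "\<And>u v i. \<lbrakk>(u, v) \<in> parcs G; u \<noteq> v; i \<le> t\<rbrakk> \<Longrightarrow> F v u (t - i) = F u v i"
    "\<And>u v. (u, v) \<in> parcs G \<Longrightarrow> F u v 0 = g u \<and> F u v t = g v"
    "\<And>u v i. \<lbrakk>(u, v) \<in> parcs G; i < t\<rbrakk> \<Longrightarrow> (F u v i, F u v (Suc i)) \<in> parcs K"
    by (rule symmetric_walk_choice[OF sym, of g t]) blast+
  have "\<exists>f. (\<forall>u. f (Branch u) = g u) \<and>
      (\<forall>u v i. (u, v) \<in> parcs G \<longrightarrow> i \<le> t \<longrightarrow> f (subdiv_point t u v i) = F u v i)"
    by (rule subdivision_map_exists) (simp_all add: F)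
  then obtain f where f: "\<And>u. f (Branch u) = g u"
    "\<And>u v i. \<lbrakk>(u, v) \<in> parcs G; i \<le> t\<rbrakk> \<Longrightarrow> f (subdiv_point t u v i) = F u v i"
    by blast
  have "(f x, f y) \<in> parcs K" if "(x, y) \<in> parcs (subdivide t G)" for x y
  proof -
    from that obtain u v i where uv: "(u, v) \<in> parcs G" "i < t"
      and "(x = subdiv_point t u v i \<and> y = subdiv_point t u v (Suc i)) \<or>
           (y = subdiv_point t u v i \<and> x = subdiv_point t u v (Suc i))"
      unfolding arc_subdivide_iff by blast
    then show ?thesis
      using f(2)[OF uv(1)] F(3)[OF uv] symD[OF sym(2) F(3)[OF uv]] by auto
  qed
  moreover have "f x \<in> pverts K" if "x \<in> pverts (subdivide t G)" for x
  proof -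
    from that consider u where "u \<in> pverts G" "x = Branch u"
      | u v i where "(u, v) \<in> parcs G" "i < t" "x = subdiv_point t u v i"
      by (auto simp: pverts_subdivide)
    then show ?thesis
    proof cases
      case 1
      then show ?thesis using g f(1) by (simp add: graph_hom_def)
    next
      \<comment> \<open>As \<open>i < t\<close>, the value \<open>F u v i\<close> is the tail of an
        arc of \<open>K\<close>.\<close>
      case 2
      then show ?thesis using f(2) F(3) K by fastforce
    qed
  qed
  ultimately have "graph_hom (subdivide t G) K f" by (simp add: graph_hom_def)
  then show "subdivide t G \<longrightarrow>\<^sub>h K" by (auto simp: hom_exists_def)
qed

section \<open>Odd powers and inverse powers\<close>

definition nbhd_images ::
  "nat \<Rightarrow> 'a pair_pre_digraph \<Rightarrow> ('a \<Rightarrow> 'b) \<Rightarrow> 'a \<Rightarrow> 'b set list" where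
  "nbhd_images r K f v = map (\<lambda>i. f ` walk_nbhd K i v) [0..<r + 1]"

lemma nbhd_images_nth [simp]: "i \<le> r \<Longrightarrow> nbhd_images r K f v ! i = f ` walk_nbhd K i v"
  by (simp add: nbhd_images_def del: upt_Suc)

text \<open>Homomorphisms preserve walks, so \<open>f\<close> maps each neighbourhood of
  \<open>v\<close> into the corresponding one of \<open>f v\<close>. For \<open>r > 0\<close> a
  neighbour of \<open>v\<close> keeps the components nonempty.\<close>

lemma nbhd_images_in_inv_power_verts:
  assumes K: "pair_sym_digraph K" and H: "pair_sym_digraph H" and f: "graph_hom K H f"
    and v: "v \<in> pverts K" and r: "r = 0 \<or> (\<exists>w. (v, w) \<in> parcs K)"
  shows "nbhd_images r K f v \<in> inv_power_verts r H"
proof -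
  have fv: "f v \<in> pverts H" using f v by (simp add: graph_hom_def)
  have nbhd: "walk_nbhd K i v = {u. (v, u) \<in> parcs K ^^ i}" for i
    using v by (simp add: walk_nbhd_relpow[OF K])
  have hom: "(f v, f u) \<in> parcs H ^^ i" if "(v, u) \<in> parcs K ^^ i" for u i
    using that by (rule relpow_hom[rotated]) (use f in \<open>simp add: graph_hom_def\<close>)
  have verts: "f u \<in> pverts H" if "(v, u) \<in> parcs K ^^ i" for u i
    using hom[OF that] fv H by (cases i) (auto simp: pair_sym_digraph_iff)
  have "\<exists>u. (v, u) \<in> parcs K ^^ i" if "i \<le> r" for i
    using r that relpow_nonempty_if_sym K by (fastforce simp: pair_sym_digraph_iff)
  then show ?thesis
    using hom verts fv
    by (auto simp: inv_power_verts_def nbhd walk_nbhd_set_def walk_nbhd_relpow[OF H])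
      (simp add: nbhd_images_def)
qed

lemma graph_hom_if_graph_hom_power:
  assumes "pair_sym_digraph K" "graph_hom (graph_power (2 * r + 1) K) H f"
  shows "graph_hom K H f"
  using assms relpow_odd_if_sym[of "parcs K" _ _ r]
  by (fastforce simp: graph_hom_def arc_graph_power_iff pair_sym_digraph_iff)

lemma nbhd_images_adjacent:
  assumes K: "pair_sym_digraph K" and f: "graph_hom (graph_power (2 * r + 1) K) H f"
    and uv: "(u, v) \<in> parcs K"
    and verts: "nbhd_images r K f u \<in> inv_power_verts r H"
      "nbhd_images r K f v \<in> inv_power_verts r H"
  shows "(nbhd_images r K f u, nbhd_images r K f v) \<in> parcs (inv_power r H)"
proof -
  have sym: "sym (parcs K)" and Kv: "parcs K \<subseteq> pverts K \<times> pverts K"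
    using K by (simp_all add: pair_sym_digraph_iff)
  \<comment> \<open>Prepending the arc \<open>(b, a)\<close> to a walk from \<open>a\<close> gives a
    walk from \<open>b\<close>.\<close>
  have incl: "walk_nbhd K i a \<subseteq> walk_nbhd K (i + 1) b" if "(b, a) \<in> parcs K" for a b i
    using that Kv by (auto simp: walk_nbhd_relpow[OF K] intro: relpow_Suc_I2 simp del: relpow.simps)
  have "(f x, f y) \<in> parcs H"
    if "j \<le> r" and x: "x \<in> walk_nbhd K j u" and y: "y \<in> walk_nbhd K j v" for j x y
  proof -
    have xu: "(x, u) \<in> parcs K ^^ j" and vy: "(v, y) \<in> parcs K ^^ j"
      using x y relpow_sym[OF sym] by (auto simp: walk_nbhd_relpow[OF K])
    \<comment> \<open>The route goes from \<open>x\<close> back to \<open>u\<close>, across the edge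
      to \<open>v\<close>, and on to \<open>y\<close>.\<close>
    then have "(x, y) \<in> parcs K ^^ Suc j O parcs K ^^ j" using uv by auto
    then have "(x, y) \<in> parcs K ^^ (2 * j + 1)"
      unfolding relpow_add[symmetric] by (simp add: mult_2 del: relpow.simps)
    then have "(x, y) \<in> parcs K ^^ (2 * r + 1)"
      using relpow_odd_mono_if_sym[OF sym] that(1) by blast
    moreover have "x \<in> pverts K"
      using xu Kv uv by (cases j) (auto dest!: relpow_Suc_D2 simp del: relpow.simps(2))
    ultimately show ?thesis
      using f by (simp add: graph_hom_def arc_graph_power_iff[OF K])
  qed
  moreover have "(v, u) \<in> parcs K" using sym uv by (rule symD)
  ultimately show ?thesis
    using verts uv incl by (auto simp: inv_power_def image_mono)
qed

text \<open>The identity homomorphism turns the neighbourhoods of \<open>x\<close> in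
  \<open>H\<close> into an admissible tuple.\<close>

lemma inv_power_verts_nonempty:
  assumes H: "pair_sym_digraph H" and xy: "(x, y) \<in> parcs H"
  shows "inv_power_verts r H \<noteq> {}"
proof -
  have "graph_hom H H id" by (simp add: graph_hom_def)
  moreover have "x \<in> pverts H" using assms by (auto simp: pair_sym_digraph_iff)
  ultimately show ?thesis
    using nbhd_images_in_inv_power_verts[OF H H] xy by blast
qed

text \<open>Each arc of the inverse power includes a component in the next one of its neighbour; the
  last index is \<open>r\<close>, whence \<open>n \<le> r\<close>.\<close>

lemma inv_power_propagate:
  assumes "\<And>i. i < n \<Longrightarrow> (g (w i), g (w (Suc i))) \<in> parcs (inv_power r H)" "n \<le> r"
  shows "g (w 0) ! 0 \<subseteq> g (w n) ! n"
  using assms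
proof (induction n)
  case (Suc n)
  have "g (w 0) ! 0 \<subseteq> g (w n) ! n" using Suc.prems by (intro Suc.IH) auto
  also have "\<dots> \<subseteq> g (w (Suc n)) ! Suc n"
    using Suc.prems(1)[of n] Suc.prems(2) by (simp add: inv_power_def)
  finally show ?case .
qed simp

text \<open>The assumption \<open>nonempty\<close> excludes edgeless \<open>K\<close> and
  \<open>H\<close> with \<open>r > 0\<close>, where \<open>inv_power r H\<close> has no vertices
  although \<open>K\<close> may map to \<open>H\<close>.\<close>

theorem graph_power_hom_iff:
  assumes K: "pair_sym_digraph K" and H: "pair_sym_digraph H"
    and nonempty: "r = 0 \<or> parcs K \<noteq> {} \<or> parcs H \<noteq> {}"
  shows "graph_power (2 * r + 1) K \<longrightarrow>\<^sub>h H \<longleftrightarrow> K \<longrightarrow>\<^sub>h inv_power r H"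
proof
  assume "graph_power (2 * r + 1) K \<longrightarrow>\<^sub>h H"
  then obtain f where f: "graph_hom (graph_power (2 * r + 1) K) H f"
    by (auto simp: hom_exists_def)
  note f' = graph_hom_if_graph_hom_power[OF K f]
  \<comment> \<open>For \<open>r > 0\<close> the neighbourhoods of an isolated vertex are empty, so it is sent to an
    arbitrary vertex \<open>A\<^sub>0\<close> instead.\<close>
  obtain A\<^sub>0 where A0: "r = 0 \<or> A\<^sub>0 \<in> inv_power_verts r H"
  proof (cases "r = 0")
    case False
    \<comment> \<open>If only \<open>K\<close> is known to have an arc, \<open>f\<close> carries it
      to an arc of \<open>H\<close>.\<close>
    then have "parcs H \<noteq> {}" using nonempty f' by (auto simp: graph_hom_def)
    then show ?thesis using that inv_power_verts_nonempty[OF H] by fastforce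
  qed (use that in blast)
  define g where
    "g v = (if r = 0 \<or> (\<exists>w. (v, w) \<in> parcs K) then nbhd_images r K f v else A\<^sub>0)" for v
  have gv: "g v \<in> inv_power_verts r H" if "v \<in> pverts K" for v
    using that A0 nbhd_images_in_inv_power_verts[OF K H f'] by (auto simp: g_def)
  have "(g u, g v) \<in> parcs (inv_power r H)" if uv: "(u, v) \<in> parcs K" for u v
  proof -
    have vu: "(v, u) \<in> parcs K" and verts: "u \<in> pverts K" "v \<in> pverts K"
      using uv K by (auto simp: pair_sym_digraph_iff dest: symD)
    \<comment> \<open>Each of \<open>u\<close> and \<open>v\<close> has the other as a neighbour, so
      neither takes the default \<open>A\<^sub>0\<close>.\<close>
    have "g u = nbhd_images r K f u" "g v = nbhd_images r K f v"
      using uv vu by (auto simp: g_def)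
    then show ?thesis
      using nbhd_images_adjacent[OF K f uv] gv verts by metis
  qed
  then have "graph_hom K (inv_power r H) g" using gv by (simp add: graph_hom_def inv_power_def)
  then show "K \<longrightarrow>\<^sub>h inv_power r H" by (auto simp: hom_exists_def)
next
  assume "K \<longrightarrow>\<^sub>h inv_power r H"
  then obtain g where g: "graph_hom K (inv_power r H) g" by (auto simp: hom_exists_def)
  define f where "f v = the_elem (g v ! 0)" for v
  have gv: "g v ! 0 = {f v}" "f v \<in> pverts H" if "v \<in> pverts K" for v
  proof -
    have "g v \<in> inv_power_verts r H" using g that by (simp add: graph_hom_def inv_power_def)
    then have "card (g v ! 0) = 1" "g v ! 0 \<subseteq> pverts H" by (auto simp: inv_power_verts_def)
    then show "g v ! 0 = {f v}" "f v \<in> pverts H"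
      unfolding f_def by (auto simp: card_1_singleton_iff)
  qed
  have "(f u, f v) \<in> parcs H"
    if u: "u \<in> pverts K" and walk: "(u, v) \<in> parcs K ^^ (2 * r + 1)" for u v
  proof -
    from walk obtain w where w: "w 0 = u" "w (2 * r + 1) = v"
      "\<And>i. i < 2 * r + 1 \<Longrightarrow> (w i, w (Suc i)) \<in> parcs K"
      unfolding relpow_fun_conv by blast
    have arc: "(g (w i), g (w (Suc i))) \<in> parcs (inv_power r H)" if "i < 2 * r + 1" for i
      using g w(3)[OF that] by (simp add: graph_hom_def)
    have sym: "sym (parcs (inv_power r H))"
      using pair_sym_digraph_inv_power[OF H] by (simp add: pair_sym_digraph_iff)
    have v: "v \<in> pverts K" using w(2) w(3)[of "2 * r"] K by (auto simp: pair_sym_digraph_iff)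
    have "g (w 0) ! 0 \<subseteq> g (w r) ! r"
      by (rule inv_power_propagate[where H = H]) (use arc in auto)
    then have "f u \<in> g (w r) ! r" using gv[OF u] w(1) by simp
    \<comment> \<open>The same propagation along the reversed walk; its \<open>r\<close>-th vertex
      is \<open>w (Suc r)\<close>.\<close>
    moreover have "g (w (2 * r + 1 - 0)) ! 0 \<subseteq> g (w (2 * r + 1 - r)) ! r"
    proof (rule inv_power_propagate[where H = H and w = "\<lambda>i. w (2 * r + 1 - i)"])
      fix i assume "i < r"
      then show "(g (w (2 * r + 1 - i)), g (w (2 * r + 1 - Suc i))) \<in> parcs (inv_power r H)"
        using symD[OF sym arc[of "2 * r + 1 - Suc i"]] by (simp add: Suc_diff_Suc Suc_diff_le)
    qed simp
    then have "f v \<in> g (w (Suc r)) ! r" using gv[OF v] w(2) by simp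
    \<comment> \<open>The middle edge of the walk joins the two last components completely.\<close>
    moreover have "\<forall>x \<in> g (w r) ! r. \<forall>y \<in> g (w (Suc r)) ! r. (x, y) \<in> parcs H"
      using arc[of r] by (auto simp: inv_power_def)
    ultimately show ?thesis by blast
  qed
  then have "graph_hom (graph_power (2 * r + 1) K) H f"
    using gv(2) by (simp add: graph_hom_def arc_graph_power_iff[OF K])
  then show "graph_power (2 * r + 1) K \<longrightarrow>\<^sub>h H" by (auto simp: hom_exists_def)
qed

section \<open>Composition of the two dualities\<close>

theorem theorem2p3:
  fixes G :: "'a pair_pre_digraph" and H :: "'b pair_pre_digraph" and r s :: nat
  assumes "pair_pseudo_graph G" and "pair_pseudo_graph H"
    and "r = 0 \<or> parcs G \<noteq> {} \<or> parcs H \<noteq> {}"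
    and "1 \<le> (2 * real r + 1) / (2 * real s + 1)"
    and "ereal ((2 * real r + 1) / (2 * real s + 1)) < ereal_of_enat (odd_girth G)"
  shows "frac_power r s G \<longrightarrow>\<^sub>h H \<longleftrightarrow> G \<longrightarrow>\<^sub>h neg_frac_power s r H"
proof -
  have G: "pair_sym_digraph G" and H: "pair_sym_digraph H"
    using assms(1,2) by (simp_all add: pair_pseudo_graph_def)
  \<comment> \<open>The second duality is applied to the subdivision, so the edge condition on
    \<open>G\<close> must pass to it.\<close>
  have "parcs (subdivide (2 * s + 1) G) \<noteq> {}" if "parcs G \<noteq> {}"
  proof -
    from that obtain u v where "(u, v) \<in> parcs G" by auto
    then have "(subdiv_point (2 * s + 1) u v 0, subdiv_point (2 * s + 1) u v (Suc 0))
        \<in> parcs (subdivide (2 * s + 1) G)"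
      unfolding arc_subdivide_iff by (metis add_gr_0 zero_less_one)
    then show ?thesis by blast
  qed
  then have "r = 0 \<or> parcs (subdivide (2 * s + 1) G) \<noteq> {} \<or> parcs H \<noteq> {}"
    using assms(3) by blast
  then have "frac_power r s G \<longrightarrow>\<^sub>h H \<longleftrightarrow> subdivide (2 * s + 1) G \<longrightarrow>\<^sub>h inv_power r H"
    unfolding frac_power_def by (rule graph_power_hom_iff[OF pair_sym_digraph_subdivide[OF G] H])
  also have "\<dots> \<longleftrightarrow> G \<longrightarrow>\<^sub>h neg_frac_power s r H"
    unfolding neg_frac_power_def
    by (rule subdivide_hom_iff[OF G pair_sym_digraph_inv_power[OF H]]) simp
  finally show ?thesis .
qed

end
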